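(* Let $H$ be a complex Hilbert space and let $\phi:B_s(H)\to B_s(H)$ be a bijective (real-)linear map. Then $\phi$ preserves the set of mean values, i.e. \[ \{\langle \phi(A)\varphi,\varphi\rangle : \varphi\in H,\ \|\varphi\|=1\}=\{\langle A\varphi,\varphi\rangle : \varphi\in H,\ \|\varphi\|=1\}\qquad\text{for every } A\in B_s(H), \] if and only if $\phi$ is an automorphism of the Jordan algebra $B_s(H)$.
   Context: $B_s(H)$ denotes the real vector space of all self-adjoint bounded linear operators on the complex Hilbert space $H$, regarded as a Jordan algebra. An automorphism of the Jordan algebra $B_s(H)$ is a bijective real-linear map $\phi:B_s(H)\to B_s(H)$ satisfying $\phi(AB+BA)=\phi(A)\phi(B)+\phi(B)\phi(A)$ for all $A,B\in B_s(H)$. *)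

theory Defs
  imports "HOL-Analysis.Analysis"
begin

(* The real inner product and the norm of a complex Hilbert space are the ones induced by
   its complex inner product, which is linear in the first argument. Positive definiteness
   of cinner follows from re_cinner. The zero space is not excluded. *)
class complex_hilbert_space = real_inner + complete_space +
  fixes scaleC :: "complex \<Rightarrow> 'a \<Rightarrow> 'a"  (infixr \<open>*\<^sub>C\<close> 75)
    and cinner :: "'a \<Rightarrow> 'a \<Rightarrow> complex"
  assumes scaleC_add_right: "c *\<^sub>C (x + y) = c *\<^sub>C x + c *\<^sub>C y"
    and scaleC_add_left: "(c + d) *\<^sub>C x = c *\<^sub>C x + d *\<^sub>C x"
    and scaleC_scaleC: "c *\<^sub>C (d *\<^sub>C x) = (c * d) *\<^sub>C x"
    and scaleR_scaleC: "r *\<^sub>R x = complex_of_real r *\<^sub>C x"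
    and cinner_commute: "cinner x y = cnj (cinner y x)"
    and cinner_add_left: "cinner (x + y) z = cinner x z + cinner y z"
    and cinner_scaleC_left: "cinner (c *\<^sub>C x) y = c * cinner x y"
    and re_cinner: "inner x y = Re (cinner x y)"

(* The library type of bounded linear maps only requires real linearity, so complex
   homogeneity is demanded explicitly. *)
definition selfadjoint_ops :: "('a::complex_hilbert_space \<Rightarrow>\<^sub>L 'a) set" where
  "selfadjoint_ops =
    {A. (\<forall>c x. blinfun_apply A (c *\<^sub>C x) = c *\<^sub>C blinfun_apply A x) \<and>
        (\<forall>x y. cinner (blinfun_apply A x) y = cinner x (blinfun_apply A y))}"

definition mean_values :: "('a::complex_hilbert_space \<Rightarrow>\<^sub>L 'a) \<Rightarrow> complex set" where
  "mean_values A = {cinner (blinfun_apply A x) x | x. norm x = 1}"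

definition real_linear_on :: "'b::real_vector set \<Rightarrow> ('b \<Rightarrow> 'c::real_vector) \<Rightarrow> bool" where
  "real_linear_on S f \<longleftrightarrow>
    (\<forall>A\<in>S. \<forall>B\<in>S. f (A + B) = f A + f B) \<and> (\<forall>r. \<forall>A\<in>S. f (r *\<^sub>R A) = r *\<^sub>R f A)"

definition jordan_automorphism ::
    "(('a::complex_hilbert_space \<Rightarrow>\<^sub>L 'a) \<Rightarrow> ('a \<Rightarrow>\<^sub>L 'a)) \<Rightarrow> bool" where
  "jordan_automorphism \<phi> \<longleftrightarrow>
    bij_betw \<phi> selfadjoint_ops selfadjoint_ops \<and>
    real_linear_on selfadjoint_ops \<phi> \<and>
    (\<forall>A\<in>selfadjoint_ops. \<forall>B\<in>selfadjoint_ops.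
      \<phi> ((A o\<^sub>L B) + (B o\<^sub>L A)) = (\<phi> A o\<^sub>L \<phi> B) + (\<phi> B o\<^sub>L \<phi> A))"

end

theory Submission imports Defs begin

text \<open>If \<open>\<phi>\<close> preserves mean values, it is a unital order isomorphism, and since mean values (unlike
  spectra) record whether a bound is attained, it maps rank-one projections to rank-one projections.
  For a rank-one projection P onto the line of x, the conditions \<open>\<langle>Bx,x\<rangle> = 0\<close> and \<open>\<parallel>Bx\<parallel> \<le> k\<close> can be
  expressed by order inequalities between B and combinations of P and \<open>1 - P\<close>. Hence for every unit
  vector y there is a unit vector x with \<open>\<langle>\<phi>(B)y,y\<rangle> = \<langle>Bx,x\<rangle>\<close> and \<open>\<parallel>\<phi>(B)y\<parallel> = \<parallel>Bx\<parallel>\<close> for all B, so that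
  \<open>\<phi>(B\<^sup>2)\<close> and \<open>\<phi>(B)\<^sup>2\<close> have the same quadratic form.

  Conversely, coercive operators are squares, so a Jordan automorphism preserves the order. It also
  preserves the triple product \<open>ABA\<close> and thereby the injectivity of positive operators. A real r is
  not a mean value of A iff \<open>A - r\<close> or \<open>r - A\<close> is positive and injective.\<close>

\<comment> \<open>Completeness passes from the space to its bounded operators, where a fixed point
  is sought later.\<close>
subclass (in complex_hilbert_space) banach ..

section \<open>Complex scalars and the complex inner product\<close>

lemma scaleC_one [simp]: "1 *\<^sub>C x = (x::'a::complex_hilbert_space)"
  using scaleR_scaleC[of 1 x] by simp

lemma cinner_scaleC_right: "cinner x (c *\<^sub>C y) = cnj c * cinner (x::'a::complex_hilbert_space) y"
  by (metis cinner_commute cinner_scaleC_left complex_cnj_mult)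

lemma cinner_add_right: "cinner (x::'a::complex_hilbert_space) (y + z) = cinner x y + cinner x z"
  by (metis cinner_commute cinner_add_left complex_cnj_add)

lemma cinner_scaleR_left: "cinner (r *\<^sub>R x) y = of_real r * cinner (x::'a::complex_hilbert_space) y"
  by (simp add: scaleR_scaleC cinner_scaleC_left)

lemma cinner_scaleR_right: "cinner x (r *\<^sub>R y) = of_real r * cinner (x::'a::complex_hilbert_space) y"
  by (simp add: scaleR_scaleC cinner_scaleC_right)

lemma cinner_diff_left: "cinner (x - y) z = cinner (x::'a::complex_hilbert_space) z - cinner y z"
  using cinner_add_left[of x "- y" z] cinner_scaleR_left[of "-1" y z] by simp

lemma cinner_scaleC_both:
  "cinner (c *\<^sub>C x) (c *\<^sub>C y) = of_real ((cmod c)\<^sup>2) * cinner (x::'a::complex_hilbert_space) y"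
  unfolding complex_norm_square by (simp add: cinner_scaleC_left cinner_scaleC_right mult.assoc)

lemma cinner_self: "cinner x x = of_real ((norm (x::'a::complex_hilbert_space))\<^sup>2)"
proof -
  have "cinner x x = cnj (cinner x x)" by (rule cinner_commute)
  then have "Im (cinner x x) = 0" by (metis complex_cnj cnj.simps(2) neg_equal_zero)
  moreover have "Re (cinner x x) = (norm x)\<^sup>2"
    by (simp add: re_cinner[symmetric] power2_norm_eq_inner)
  ultimately show ?thesis by (simp add: complex_eq_iff)
qed

lemma norm_scaleC: "norm (c *\<^sub>C x) = cmod c * norm (x::'a::complex_hilbert_space)"
proof -
  have "(norm (c *\<^sub>C x))\<^sup>2 = (cmod c * norm x)\<^sup>2"
    by (simp only: power2_norm_eq_inner[of "c *\<^sub>C x"] re_cinner cinner_scaleC_both)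
      (simp add: cinner_self power_mult_distrib)
  then show ?thesis by (simp add: power2_eq_iff_nonneg)
qed

lemma scaleC_scaleR_commute: "c *\<^sub>C (r *\<^sub>R x) = r *\<^sub>R (c *\<^sub>C (x::'a::complex_hilbert_space))"
  by (simp add: scaleR_scaleC scaleC_scaleC mult.commute)

section \<open>Self-adjoint operators and their quadratic forms\<close>

lemma sa_symmetric:
  "A \<in> selfadjoint_ops \<Longrightarrow> inner (blinfun_apply A x) y = inner x (blinfun_apply A y)"
  by (simp add: selfadjoint_ops_def re_cinner)

lemma sa_cinner:
  "A \<in> selfadjoint_ops \<Longrightarrow> cinner (blinfun_apply A x) y = cinner x (blinfun_apply A y)"
  by (simp add: selfadjoint_ops_def)

lemma sa_scaleC:
  "A \<in> selfadjoint_ops \<Longrightarrow> blinfun_apply A (c *\<^sub>C x) = c *\<^sub>C blinfun_apply A x"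
  by (simp add: selfadjoint_ops_def)

lemma sa_add: "A \<in> selfadjoint_ops \<Longrightarrow> B \<in> selfadjoint_ops \<Longrightarrow> A + B \<in> selfadjoint_ops"
  by (auto simp: selfadjoint_ops_def blinfun.add_left scaleC_add_right cinner_add_left cinner_add_right)

lemma sa_scaleR: "A \<in> selfadjoint_ops \<Longrightarrow> r *\<^sub>R A \<in> selfadjoint_ops"
  by (auto simp: selfadjoint_ops_def blinfun.scaleR_left scaleC_scaleR_commute cinner_scaleR_left
      cinner_scaleR_right)

lemma sa_uminus: "A \<in> selfadjoint_ops \<Longrightarrow> - A \<in> selfadjoint_ops"
  using sa_scaleR[of A "-1"] by simp

lemma sa_diff: "A \<in> selfadjoint_ops \<Longrightarrow> B \<in> selfadjoint_ops \<Longrightarrow> A - B \<in> selfadjoint_ops"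
  using sa_add[OF _ sa_uminus, of A B] by simp

lemma sa_id: "id_blinfun \<in> selfadjoint_ops"
  by (simp add: selfadjoint_ops_def)

lemma sa_zero: "0 \<in> selfadjoint_ops"
  using sa_diff[OF sa_id sa_id] by simp

lemma sa_sandwich:
  "A \<in> selfadjoint_ops \<Longrightarrow> B \<in> selfadjoint_ops \<Longrightarrow> A o\<^sub>L B o\<^sub>L A \<in> selfadjoint_ops"
  by (simp add: selfadjoint_ops_def)

lemma sa_square: "A \<in> selfadjoint_ops \<Longrightarrow> A o\<^sub>L A \<in> selfadjoint_ops"
  by (simp add: selfadjoint_ops_def)

lemma sa_jordan:
  "A \<in> selfadjoint_ops \<Longrightarrow> B \<in> selfadjoint_ops \<Longrightarrow> (A o\<^sub>L B) + (B o\<^sub>L A) \<in> selfadjoint_ops"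
  by (simp add: selfadjoint_ops_def blinfun.add_left scaleC_add_right cinner_add_left
      cinner_add_right add.commute)

definition qf :: "('a::complex_hilbert_space \<Rightarrow>\<^sub>L 'a) \<Rightarrow> 'a \<Rightarrow> real" where
  "qf A x = inner (blinfun_apply A x) x"

lemma qf_add: "qf (A + B) x = qf A x + qf B x"
  and qf_diff: "qf (A - B) x = qf A x - qf B x"
  and qf_minus: "qf (- A) x = - qf A x"
  and qf_scaleR: "qf (r *\<^sub>R A) x = r * qf A x"
  and qf_id: "qf id_blinfun x = (norm x)\<^sup>2"
  by (simp_all add: qf_def blinfun.add_left blinfun.diff_left blinfun.minus_left
      blinfun.scaleR_left inner_add_left inner_diff_left power2_norm_eq_inner)

lemmas qf_simps = qf_add qf_diff qf_minus qf_scaleR qf_id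

lemma qf_scale: "qf A (r *\<^sub>R x) = r\<^sup>2 * qf A x"
  by (simp add: qf_def blinfun.scaleR_right power2_eq_square)

lemma qf_scaleC: "A \<in> selfadjoint_ops \<Longrightarrow> qf A (c *\<^sub>C x) = (cmod c)\<^sup>2 * qf A x"
proof -
  assume A: "A \<in> selfadjoint_ops"
  show ?thesis
    unfolding qf_def re_cinner sa_scaleC[OF A] cinner_scaleC_both by simp
qed

lemma qf_plus:
  assumes "A \<in> selfadjoint_ops"
  shows "qf A (x + y) = qf A x + 2 * inner (blinfun_apply A x) y + qf A y"
  using sa_symmetric[OF assms, of y x]
  by (simp add: qf_def blinfun.add_right inner_add_left inner_add_right inner_commute)

lemma qf_square: "A \<in> selfadjoint_ops \<Longrightarrow> qf (A o\<^sub>L A) x = (norm (blinfun_apply A x))\<^sup>2"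
  by (simp add: qf_def sa_symmetric power2_norm_eq_inner)

lemma qf_le_norm: "qf A x \<le> norm A * (norm x)\<^sup>2"
proof -
  have "qf A x \<le> norm (blinfun_apply A x) * norm x"
    unfolding qf_def by (rule norm_cauchy_schwarz)
  also have "\<dots> \<le> norm A * norm x * norm x"
    by (intro mult_right_mono norm_blinfun) simp
  finally show ?thesis by (simp add: power2_eq_square)
qed

lemma qf_normalize:
  assumes "x \<noteq> 0"
  obtains u where "norm u = 1" "qf A x = (norm x)\<^sup>2 * qf A u"
proof
  show "norm (inverse (norm x) *\<^sub>R x) = 1" using assms by simp
  show "qf A x = (norm x)\<^sup>2 * qf A (inverse (norm x) *\<^sub>R x)"
    using assms by (simp add: qf_scale power_inverse)
qed

text \<open>Self-adjointness makes each mean value equal to its own conjugate, so everything below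
  can work with the real form \<open>qf\<close>.\<close>

lemma sa_mean_values:
  assumes "A \<in> selfadjoint_ops"
  shows "mean_values A = {complex_of_real (qf A x) | x. norm x = 1}"
proof -
  have "cinner (blinfun_apply A x) x = of_real (qf A x)" for x
  proof -
    have "cinner (blinfun_apply A x) x = cnj (cinner (blinfun_apply A x) x)"
      using sa_cinner[OF assms, of x x] cinner_commute[of x "blinfun_apply A x"] by simp
    then have "Im (cinner (blinfun_apply A x) x) = 0" by (metis cnj.simps(2) neg_equal_zero)
    then show ?thesis by (simp add: complex_eq_iff qf_def re_cinner)
  qed
  then show ?thesis by (simp add: mean_values_def)
qed

definition pos_op :: "('a::complex_hilbert_space \<Rightarrow>\<^sub>L 'a) \<Rightarrow> bool" where
  "pos_op A \<longleftrightarrow> (\<forall>x. 0 \<le> qf A x)"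

lemma pos_op_iff_mean_values:
  assumes "A \<in> selfadjoint_ops"
  shows "pos_op A \<longleftrightarrow> (\<forall>w\<in>mean_values A. 0 \<le> Re w)"
proof
  assume "\<forall>w\<in>mean_values A. 0 \<le> Re w"
  then have u: "0 \<le> qf A u" if "norm u = 1" for u
    using that by (force simp: sa_mean_values[OF assms])
  have "0 \<le> qf A x" for x
  proof (cases "x = 0")
    case False
    then show ?thesis by (metis qf_normalize u mult_nonneg_nonneg zero_le_power2)
  qed (simp add: qf_def)
  then show "pos_op A" by (simp add: pos_op_def)
qed (auto simp: sa_mean_values[OF assms] pos_op_def)

text \<open>At x the form has its minimum 0. If \<open>A x\<close> were nonzero, a small step from x
  against \<open>A x\<close> would make the form negative, because the linear term
  \<open>2 * t * n\<close> beats \<open>t\<^sup>2 * m\<close>.\<close>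

lemma pos_op_null_vector:
  assumes A: "A \<in> selfadjoint_ops" and "pos_op A" and x: "qf A x = 0"
  shows "blinfun_apply A x = 0"
proof (rule ccontr)
  define n m where "n = (norm (blinfun_apply A x))\<^sup>2" and "m = qf A (blinfun_apply A x)"
  assume "blinfun_apply A x \<noteq> 0"
  then have n: "n > 0" by (simp add: n_def)
  have m: "m \<ge> 0" using assms by (simp add: m_def pos_op_def)
  \<comment> \<open>Dividing by \<open>m + 1\<close> instead of m also covers m = 0.\<close>
  define t where "t = - n / (m + 1)"
  have "0 \<le> qf A (x + t *\<^sub>R blinfun_apply A x)" using assms by (simp add: pos_op_def)
  also have "\<dots> = 2 * t * n + t\<^sup>2 * m"
    by (simp add: qf_plus[OF A] x qf_scale n_def m_def power2_norm_eq_inner)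
  finally have "0 \<le> (2 * t * n + t\<^sup>2 * m) * (m + 1)\<^sup>2" by simp
  also have "\<dots> = 2 * (t * (m + 1)) * n * (m + 1) + (t * (m + 1))\<^sup>2 * m"
    by (simp add: power2_eq_square algebra_simps)
  also have "t * (m + 1) = - n" using m by (simp add: t_def)
  also have "2 * (- n) * n * (m + 1) + (- n)\<^sup>2 * m = n\<^sup>2 * (- m - 2)"
    by (simp add: power2_eq_square algebra_simps)
  also have "\<dots> < 0" using n m by (intro mult_pos_neg) auto
  finally show False by simp
qed

lemma sa_eqI:
  assumes A: "A \<in> selfadjoint_ops" and B: "B \<in> selfadjoint_ops"
    and eq: "\<And>u. norm u = 1 \<Longrightarrow> qf A u = qf B u"
  shows "A = B"
proof -
  have z: "qf (A - B) x = 0" for x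
  proof (cases "x = 0")
    case False
    then obtain u where "norm u = 1" "qf (A - B) x = (norm x)\<^sup>2 * qf (A - B) u"
      by (rule qf_normalize)
    then show ?thesis using eq by (simp add: qf_diff)
  qed (simp add: qf_def)
  then have "blinfun_apply (A - B) x = 0" for x
    by (intro pos_op_null_vector sa_diff A B) (simp_all add: pos_op_def)
  then show ?thesis by (intro blinfun_eqI) (simp add: blinfun.diff_left)
qed

section \<open>Rank-one projections\<close>

definition proj1 :: "'a::complex_hilbert_space \<Rightarrow> 'a \<Rightarrow>\<^sub>L 'a" where
  "proj1 x = Blinfun (\<lambda>z. cinner z x *\<^sub>C x)"

text \<open>Real and imaginary parts are estimated separately by the real Cauchy-Schwarz inequality.
  The resulting factor 2 is harmless, as the bound serves only to show that \<open>proj1\<close> is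
  bounded.\<close>

lemma norm_cinner_le: "cmod (cinner z x) \<le> 2 * (norm z * norm (x::'a::complex_hilbert_space))"
proof -
  have "Im (cinner z x) = inner z (\<i> *\<^sub>C x)"
    by (simp add: re_cinner cinner_scaleC_right)
  then have "\<bar>Im (cinner z x)\<bar> \<le> norm z * norm x"
    using Cauchy_Schwarz_ineq2[of z "\<i> *\<^sub>C x"] by (simp add: norm_scaleC)
  moreover have "\<bar>Re (cinner z x)\<bar> \<le> norm z * norm x"
    using Cauchy_Schwarz_ineq2[of z x] by (simp add: re_cinner)
  ultimately show ?thesis using cmod_le[of "cinner z x"] by linarith
qed

lemma proj1_apply: "blinfun_apply (proj1 x) z = cinner z x *\<^sub>C (x::'a::complex_hilbert_space)"
proof -
  have "bounded_linear (\<lambda>z. cinner z x *\<^sub>C x)"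
  proof (rule bounded_linear_intro[where K = "2 * (norm x)\<^sup>2"])
    fix z
    have "cmod (cinner z x) * norm x \<le> 2 * (norm z * norm x) * norm x"
      by (intro mult_right_mono norm_cinner_le) simp
    then show "norm (cinner z x *\<^sub>C x) \<le> norm z * (2 * (norm x)\<^sup>2)"
      by (simp add: norm_scaleC power2_eq_square algebra_simps)
  qed (simp_all add: cinner_add_left scaleC_add_left scaleR_scaleC scaleC_scaleC cinner_scaleC_left)
  then show ?thesis by (simp add: proj1_def bounded_linear_Blinfun_apply)
qed

lemma sa_proj1: "proj1 x \<in> selfadjoint_ops"
proof -
  have "cinner (cinner y x *\<^sub>C x) z = cinner y (cinner z x *\<^sub>C x)" for y z
    using cinner_commute[of x z] by (simp add: cinner_scaleC_left cinner_scaleC_right)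
  then show ?thesis
    by (simp add: selfadjoint_ops_def proj1_apply cinner_scaleC_left scaleC_scaleC)
qed

lemma qf_proj1: "qf (proj1 x) z = (cmod (cinner z x))\<^sup>2"
proof -
  have "cinner x z = cnj (cinner z x)" by (rule cinner_commute)
  then have "qf (proj1 x) z = Re (cinner z x * cnj (cinner z x))"
    by (simp add: qf_def re_cinner proj1_apply cinner_scaleC_left)
  then show ?thesis unfolding complex_norm_square[symmetric] by simp
qed

lemma qf_id_minus_proj1:
  assumes "norm x = 1"
  shows "qf (id_blinfun - proj1 x) z = (norm (z - cinner z x *\<^sub>C x))\<^sup>2"
proof -
  have "inner z (cinner z x *\<^sub>C x) = qf (proj1 x) z"
    by (simp add: qf_def proj1_apply inner_commute)
  moreover have "inner (cinner z x *\<^sub>C x) (cinner z x *\<^sub>C x) = (cmod (cinner z x))\<^sup>2"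
    by (simp add: power2_norm_eq_inner[symmetric] norm_scaleC assms)
  ultimately show ?thesis
    by (simp add: power2_norm_eq_inner qf_simps qf_proj1 inner_diff_left inner_diff_right inner_commute)
qed

lemma proj1_self: "norm x = 1 \<Longrightarrow> blinfun_apply (proj1 x) x = x"
  by (simp add: proj1_apply cinner_self)

lemma pos_proj1: "pos_op (proj1 x)"
  by (simp add: pos_op_def qf_proj1)

lemma pos_id_minus_proj1: "norm x = 1 \<Longrightarrow> pos_op (id_blinfun - proj1 x)"
  by (simp add: pos_op_def qf_id_minus_proj1)

text \<open>On vectors orthogonal to y the form of B is squeezed between 0 and 0, so B annihilates
  them and only its action along y remains.\<close>

lemma below_proj1:
  assumes B: "B \<in> selfadjoint_ops" and y: "norm y = 1"
    and pos: "pos_op B" and le: "pos_op (proj1 y - B)"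
  shows "B = qf B y *\<^sub>R proj1 y"
proof (rule sa_eqI[OF B sa_scaleR[OF sa_proj1]])
  fix z :: 'a
  define w where "w = z - cinner z y *\<^sub>C y"
  have "cinner w y = 0" by (simp add: w_def cinner_diff_left cinner_scaleC_left cinner_self y)
  then have "qf B w = 0"
    using pos le by (force simp: pos_op_def qf_diff qf_proj1 intro: antisym dest: spec[of _ w])
  then have "blinfun_apply B w = 0" by (rule pos_op_null_vector[OF B pos])
  then have "qf B (w + cinner z y *\<^sub>C y) = qf B (cinner z y *\<^sub>C y)"
    unfolding qf_plus[OF B] by (simp add: qf_def)
  then show "qf B z = qf (qf B y *\<^sub>R proj1 y) z"
    by (simp add: w_def qf_scaleC[OF B] qf_scaleR qf_proj1)
qed

text \<open>Since A is symmetric and fixes x, the form of A has no cross term between the line of x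
  and its orthogonal complement.\<close>

lemma proj1_below:
  assumes A: "A \<in> selfadjoint_ops" and x: "norm x = 1" and pos: "pos_op A"
    and fixed: "blinfun_apply A x = x"
  shows "pos_op (A - proj1 x)"
  unfolding pos_op_def
proof
  fix z :: 'a
  define c w where "c = cinner z x" and "w = z - c *\<^sub>C x"
  have "cinner w x = 0" by (simp add: w_def c_def cinner_diff_left cinner_scaleC_left cinner_self x)
  then have "cinner (c *\<^sub>C x) w = 0" by (metis cinner_commute cinner_scaleC_right mult_zero_right complex_cnj_zero)
  then have "qf A (c *\<^sub>C x + w) = (cmod c)\<^sup>2 * qf A x + qf A w"
    by (simp add: qf_plus[OF A] qf_scaleC[OF A] sa_scaleC[OF A] fixed re_cinner)
  moreover have "qf A x = 1" by (simp add: qf_def fixed power2_norm_eq_inner[symmetric] x)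
  moreover have "c *\<^sub>C x + w = z" by (simp add: w_def)
  ultimately show "0 \<le> qf (A - proj1 x) z"
    using pos by (simp add: qf_diff qf_proj1 c_def pos_op_def)
qed

text \<open>For \<open>z = \<alpha>x + w\<close> with w orthogonal to x, the cross term \<open>2 Re \<langle>B(\<alpha>x),w\<rangle>\<close> is at most
  \<open>2 k \<bar>\<alpha>\<bar> \<parallel>w\<parallel>\<close>, and this is the infimum over \<open>a > 0\<close> of \<open>a \<bar>\<alpha>\<bar>\<^sup>2 + (k\<^sup>2 / a) \<parallel>w\<parallel>\<^sup>2\<close>; b absorbs \<open>\<langle>Bw,w\<rangle>\<close>.\<close>

definition dominated :: "('a::complex_hilbert_space \<Rightarrow>\<^sub>L 'a) \<Rightarrow> ('a \<Rightarrow>\<^sub>L 'a) \<Rightarrow> real \<Rightarrow> bool" where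
  "dominated B P k \<longleftrightarrow> (\<exists>b. \<forall>a>0.
     pos_op (a *\<^sub>R P + (k\<^sup>2 / a + b) *\<^sub>R (id_blinfun - P) - B) \<and>
     pos_op (a *\<^sub>R P + (k\<^sup>2 / a + b) *\<^sub>R (id_blinfun - P) + B))"

lemma proj1_upper_bound:
  assumes B: "B \<in> selfadjoint_ops" and x: "norm x = 1" and a: "a > 0"
    and mean: "qf B x = 0" and k: "norm (blinfun_apply B x) \<le> k"
  shows "pos_op (a *\<^sub>R proj1 x + (k\<^sup>2 / a + norm B) *\<^sub>R (id_blinfun - proj1 x) - B)"
  unfolding pos_op_def
proof
  fix z
  define c w where "c = cinner z x" and "w = z - c *\<^sub>C x"
  have "qf B z = qf B (c *\<^sub>C x + w)" by (simp add: w_def)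
  also have "\<dots> = 2 * inner (blinfun_apply B (c *\<^sub>C x)) w + qf B w"
    by (simp add: qf_plus[OF B] qf_scaleC[OF B] mean)
  also have "\<dots> \<le> 2 * (cmod c * k * norm w) + norm B * (norm w)\<^sup>2"
  proof -
    have "inner (blinfun_apply B (c *\<^sub>C x)) w \<le> cmod c * norm (blinfun_apply B x) * norm w"
      using norm_cauchy_schwarz[of "blinfun_apply B (c *\<^sub>C x)" w]
      by (simp add: sa_scaleC[OF B] norm_scaleC)
    also have "\<dots> \<le> cmod c * k * norm w"
      by (intro mult_right_mono mult_left_mono k) auto
    finally show ?thesis using qf_le_norm[of B w] by linarith
  qed
  also have "2 * (cmod c * k * norm w) \<le> a * (cmod c)\<^sup>2 + (k\<^sup>2 / a) * (norm w)\<^sup>2"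
  proof -
    have "0 \<le> (a * cmod c - k * norm w)\<^sup>2 / a" using a by simp
    also have "\<dots> = a * (cmod c)\<^sup>2 + (k\<^sup>2 / a) * (norm w)\<^sup>2 - 2 * (cmod c * k * norm w)"
      using a by (simp add: field_simps power2_eq_square)
    finally show ?thesis by simp
  qed
  finally have "qf B z \<le> a * (cmod c)\<^sup>2 + (k\<^sup>2 / a + norm B) * (norm w)\<^sup>2"
    by (simp add: algebra_simps)
  moreover have "qf (id_blinfun - proj1 x) z = (norm w)\<^sup>2"
    by (simp add: qf_id_minus_proj1[OF x] w_def c_def)
  ultimately show "0 \<le> qf (a *\<^sub>R proj1 x + (k\<^sup>2 / a + norm B) *\<^sub>R (id_blinfun - proj1 x) - B) z"
    by (simp add: qf_add qf_diff[of _ B] qf_scaleR qf_proj1 c_def)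
qed

lemma le_zero_of_le_small:
  assumes "\<And>a::real. a > 0 \<Longrightarrow> u \<le> a * v"
  shows "u \<le> 0"
proof (rule ccontr)
  assume u: "\<not> u \<le> 0"
  \<comment> \<open>This a makes \<open>a * \<bar>v\<bar>\<close> smaller than u, and the summand 1
    keeps the denominator positive.\<close>
  have "u \<le> u / (2 * (\<bar>v\<bar> + 1)) * v" using u by (intro assms) auto
  also have "\<dots> \<le> u / (2 * (\<bar>v\<bar> + 1)) * \<bar>v\<bar>" using u by (intro mult_left_mono) auto
  also have "\<dots> < u" using u by (simp add: field_simps add_nonneg_pos)
  finally show False by simp
qed

text \<open>This turns a mean value and a norm into order conditions. Sufficiency is the upper bound
  for B and for -B with b = \<open>norm B\<close>. For necessity, the inequality is tested at x and
  at combinations of x and \<open>B x\<close>, and a tends to 0.\<close>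

lemma dominated_proj1_iff:
  assumes B: "B \<in> selfadjoint_ops" and x: "norm x = 1" and k0: "0 \<le> k"
  shows "dominated B (proj1 x) k \<longleftrightarrow> qf B x = 0 \<and> norm (blinfun_apply B x) \<le> k"
proof
  assume "qf B x = 0 \<and> norm (blinfun_apply B x) \<le> k"
  then show "dominated B (proj1 x) k"
    using proj1_upper_bound[OF B x, of _ k] proj1_upper_bound[OF sa_uminus[OF B] x, of _ k]
    unfolding dominated_def by (intro exI[of _ "norm B"]) (simp add: qf_minus blinfun.minus_left)
next
  assume "dominated B (proj1 x) k"
  then obtain b where b': "\<And>a. a > 0 \<Longrightarrow>
      pos_op (a *\<^sub>R proj1 x + (k\<^sup>2 / a + b) *\<^sub>R (id_blinfun - proj1 x) - B) \<and>
      pos_op (a *\<^sub>R proj1 x + (k\<^sup>2 / a + b) *\<^sub>R (id_blinfun - proj1 x) + B)"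
    unfolding dominated_def by blast
  have b: "\<bar>qf B z\<bar> \<le> a * qf (proj1 x) z + (k\<^sup>2 / a + b) * qf (id_blinfun - proj1 x) z"
    if "a > 0" for a z
  proof -
    have "0 \<le> qf (a *\<^sub>R proj1 x + (k\<^sup>2 / a + b) *\<^sub>R (id_blinfun - proj1 x) - B) z"
      "0 \<le> qf (a *\<^sub>R proj1 x + (k\<^sup>2 / a + b) *\<^sub>R (id_blinfun - proj1 x) + B) z"
      using b'[OF that] by (simp_all add: pos_op_def)
    then show ?thesis unfolding qf_add qf_diff[of _ B] qf_scaleR by linarith
  qed
  have "\<bar>qf B x\<bar> \<le> a * 1" if "a > 0" for a
    using b[OF that, of x] by (simp add: qf_id_minus_proj1 qf_proj1 cinner_self x)
  then have mean: "qf B x = 0" using le_zero_of_le_small[of "\<bar>qf B x\<bar>" 1] by simp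
  define w n where "w = blinfun_apply B x" and "n = norm w"
  \<comment> \<open>A vanishing \<open>qf\<close> controls only the real part; the imaginary part
    vanishes because B is self-adjoint.\<close>
  have wx: "cinner w x = 0"
  proof -
    have "cinner w x \<in> mean_values B" using x by (auto simp: mean_values_def w_def)
    then obtain u where "cinner w x = of_real (qf B u)" by (auto simp: sa_mean_values[OF B])
    moreover have "Re (cinner w x) = 0" using mean by (simp add: qf_def w_def re_cinner)
    ultimately show ?thesis by simp
  qed
  have "n ^ 4 - k\<^sup>2 * n\<^sup>2 \<le> a * (b * n\<^sup>2 - qf B w)" if a: "a > 0" for a
  proof -
    \<comment> \<open>This r maximises \<open>2 * r * n\<^sup>2 - a * r\<^sup>2\<close>. After
      multiplication by a, every term except \<open>n ^ 4\<close> and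
      \<open>k\<^sup>2 * n\<^sup>2\<close> carries the factor a.\<close>
    define r where "r = n\<^sup>2 / a"
    define z where "z = r *\<^sub>R x + w"
    have c: "cinner z x = of_real r"
      by (simp add: z_def cinner_add_left cinner_scaleR_left wx cinner_self x)
    have "qf B z = 2 * r * n\<^sup>2 + qf B w"
      by (simp add: z_def qf_plus[OF B] qf_scale mean blinfun.scaleR_right w_def[symmetric] n_def
          power2_norm_eq_inner)
    moreover have "z - cinner z x *\<^sub>C x = w" unfolding c by (simp add: z_def scaleR_scaleC)
    ultimately have "2 * r * n\<^sup>2 + qf B w \<le> a * r\<^sup>2 + (k\<^sup>2 / a + b) * n\<^sup>2"
      using b[OF a, of z] by (simp add: qf_proj1 qf_id_minus_proj1[OF x] c n_def)
    then have "a * (2 * r * n\<^sup>2 + qf B w) \<le> a * (a * r\<^sup>2 + (k\<^sup>2 / a + b) * n\<^sup>2)"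
      using a by (intro mult_left_mono) auto
    also have "\<dots> = (a * r)\<^sup>2 + k\<^sup>2 * n\<^sup>2 + a * (b * n\<^sup>2)"
      using a by (simp add: power2_eq_square algebra_simps)
    finally have "2 * (a * r) * n\<^sup>2 + a * qf B w \<le> (a * r)\<^sup>2 + k\<^sup>2 * n\<^sup>2 + a * (b * n\<^sup>2)"
      by (simp add: algebra_simps)
    moreover have "a * r = n\<^sup>2" using a by (simp add: r_def)
    ultimately show ?thesis
      by (simp add: power2_eq_square power4_eq_xxxx algebra_simps)
  qed
  then have "n ^ 4 - k\<^sup>2 * n\<^sup>2 \<le> 0" by (rule le_zero_of_le_small)
  then have "n\<^sup>2 * n\<^sup>2 \<le> k\<^sup>2 * n\<^sup>2" by (simp add: power4_eq_xxxx power2_eq_square)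
  then have "n \<le> k"
  proof (cases "n = 0")
    case False
    then have "0 < n\<^sup>2" by simp
    with \<open>n\<^sup>2 * n\<^sup>2 \<le> k\<^sup>2 * n\<^sup>2\<close> have "n\<^sup>2 \<le> k\<^sup>2" by (rule mult_right_le_imp_le)
    then show ?thesis using k0 by (rule power2_le_imp_le)
  qed (use k0 in simp)
  then show "qf B x = 0 \<and> norm (blinfun_apply B x) \<le> k" using mean by (simp add: n_def w_def)
qed

section \<open>Linear bijections of the self-adjoint operators\<close>

definition sa_linear_bij ::
    "(('a::complex_hilbert_space \<Rightarrow>\<^sub>L 'a) \<Rightarrow> ('a \<Rightarrow>\<^sub>L 'a)) \<Rightarrow> bool" where
  "sa_linear_bij \<phi> \<longleftrightarrow>
    bij_betw \<phi> selfadjoint_ops selfadjoint_ops \<and> real_linear_on selfadjoint_ops \<phi>"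

text \<open>The inverse is taken relative to the self-adjoint operators, since the values of \<phi>
  elsewhere are unconstrained.\<close>

definition sa_inv ::
    "(('a::complex_hilbert_space \<Rightarrow>\<^sub>L 'a) \<Rightarrow> ('a \<Rightarrow>\<^sub>L 'a)) \<Rightarrow> ('a \<Rightarrow>\<^sub>L 'a) \<Rightarrow> ('a \<Rightarrow>\<^sub>L 'a)" where
  "sa_inv \<phi> = inv_into selfadjoint_ops \<phi>"

lemma lin_sa: "sa_linear_bij \<phi> \<Longrightarrow> A \<in> selfadjoint_ops \<Longrightarrow> \<phi> A \<in> selfadjoint_ops"
  by (auto simp: sa_linear_bij_def bij_betw_def)

lemma lin_add:
  "\<lbrakk>sa_linear_bij \<phi>; A \<in> selfadjoint_ops; B \<in> selfadjoint_ops\<rbrakk> \<Longrightarrow> \<phi> (A + B) = \<phi> A + \<phi> B"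
  by (simp add: sa_linear_bij_def real_linear_on_def)

lemma lin_scaleR:
  "\<lbrakk>sa_linear_bij \<phi>; A \<in> selfadjoint_ops\<rbrakk> \<Longrightarrow> \<phi> (r *\<^sub>R A) = r *\<^sub>R \<phi> A"
  by (simp add: sa_linear_bij_def real_linear_on_def)

lemma lin_diff:
  "\<lbrakk>sa_linear_bij \<phi>; A \<in> selfadjoint_ops; B \<in> selfadjoint_ops\<rbrakk> \<Longrightarrow> \<phi> (A - B) = \<phi> A - \<phi> B"
  using lin_add[of \<phi> A "(-1) *\<^sub>R B"] lin_scaleR[of \<phi> B "-1"] by (simp add: sa_uminus)

lemma lin_zero: "sa_linear_bij \<phi> \<Longrightarrow> \<phi> 0 = 0"
  using lin_scaleR[of \<phi> 0 0] by (simp add: sa_zero)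

lemma lin_inj:
  "\<lbrakk>sa_linear_bij \<phi>; \<phi> A = \<phi> B; A \<in> selfadjoint_ops; B \<in> selfadjoint_ops\<rbrakk> \<Longrightarrow> A = B"
  by (auto simp: sa_linear_bij_def bij_betw_def inj_on_def)

lemma sa_inv_sa: "\<lbrakk>sa_linear_bij \<phi>; A \<in> selfadjoint_ops\<rbrakk> \<Longrightarrow> sa_inv \<phi> A \<in> selfadjoint_ops"
  unfolding sa_inv_def by (rule inv_into_into) (simp add: sa_linear_bij_def bij_betw_def)

lemma lin_sa_inv: "\<lbrakk>sa_linear_bij \<phi>; A \<in> selfadjoint_ops\<rbrakk> \<Longrightarrow> \<phi> (sa_inv \<phi> A) = A"
  unfolding sa_inv_def by (rule f_inv_into_f) (simp add: sa_linear_bij_def bij_betw_def)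

lemma sa_inv_eqI:
  "\<lbrakk>sa_linear_bij \<phi>; A \<in> selfadjoint_ops; \<phi> A = B\<rbrakk> \<Longrightarrow> sa_inv \<phi> B = A"
  unfolding sa_inv_def by (rule inv_into_f_eq) (simp_all add: sa_linear_bij_def bij_betw_def)

lemma sa_linear_bij_inv:
  assumes "sa_linear_bij \<phi>"
  shows "sa_linear_bij (sa_inv \<phi>)"
proof -
  have "bij_betw (sa_inv \<phi>) selfadjoint_ops selfadjoint_ops"
    using assms unfolding sa_inv_def by (intro bij_betw_inv_into) (simp add: sa_linear_bij_def)
  moreover have "sa_inv \<phi> (A + B) = sa_inv \<phi> A + sa_inv \<phi> B"
    if "A \<in> selfadjoint_ops" "B \<in> selfadjoint_ops" for A B
    using that by (intro sa_inv_eqI[OF assms])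
      (simp_all add: sa_add sa_inv_sa[OF assms] lin_add[OF assms] lin_sa_inv[OF assms])
  moreover have "sa_inv \<phi> (r *\<^sub>R A) = r *\<^sub>R sa_inv \<phi> A" if "A \<in> selfadjoint_ops" for A r
    using that by (intro sa_inv_eqI[OF assms])
      (simp_all add: sa_scaleR sa_inv_sa[OF assms] lin_scaleR[OF assms] lin_sa_inv[OF assms])
  ultimately show ?thesis by (simp add: sa_linear_bij_def real_linear_on_def)
qed

section \<open>Preservers of mean values\<close>

definition mean_value_iso ::
    "(('a::complex_hilbert_space \<Rightarrow>\<^sub>L 'a) \<Rightarrow> ('a \<Rightarrow>\<^sub>L 'a)) \<Rightarrow> bool" where
  "mean_value_iso \<phi> \<longleftrightarrow>
    sa_linear_bij \<phi> \<and> (\<forall>A\<in>selfadjoint_ops. mean_values (\<phi> A) = mean_values A)"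

lemma mean_value_iso_inv: "mean_value_iso \<phi> \<Longrightarrow> mean_value_iso (sa_inv \<phi>)"
  unfolding mean_value_iso_def by (metis sa_linear_bij_inv sa_inv_sa lin_sa_inv)

lemma mean_value_iso_pos:
  "\<lbrakk>mean_value_iso \<phi>; A \<in> selfadjoint_ops\<rbrakk> \<Longrightarrow> pos_op (\<phi> A) \<longleftrightarrow> pos_op A"
  by (simp add: mean_value_iso_def pos_op_iff_mean_values lin_sa)

text \<open>The identity has no mean value other than 1, and the form on unit vectors determines a
  self-adjoint operator.\<close>

lemma mean_value_iso_id:
  fixes \<phi> :: "('a::complex_hilbert_space \<Rightarrow>\<^sub>L 'a) \<Rightarrow> ('a \<Rightarrow>\<^sub>L 'a)"
  assumes "mean_value_iso \<phi>"
  shows "\<phi> id_blinfun = id_blinfun"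
proof -
  have lin: "sa_linear_bij \<phi>" using assms by (simp add: mean_value_iso_def)
  have sa: "\<phi> id_blinfun \<in> selfadjoint_ops" by (rule lin_sa[OF lin sa_id])
  show ?thesis
  proof (rule sa_eqI[OF sa sa_id])
    fix u :: 'a assume u: "norm u = 1"
    then have "complex_of_real (qf (\<phi> id_blinfun) u) \<in> mean_values (\<phi> id_blinfun)"
      by (auto simp: sa_mean_values[OF sa])
    also have "\<dots> = mean_values (id_blinfun :: 'a \<Rightarrow>\<^sub>L 'a)"
      using assms by (simp add: mean_value_iso_def sa_id)
    finally show "qf (\<phi> id_blinfun) u = qf id_blinfun u"
      by (auto simp: sa_mean_values[OF sa_id] qf_id u)
  qed
qed

text \<open>The value 1 of \<open>proj1 y\<close> is attained, so \<open>\<phi> (proj1 y)\<close> has a unit fixed vector x. The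
  preimage of \<open>proj1 x\<close> then lies below \<open>proj1 y\<close>, hence is a multiple of it.\<close>

lemma mean_value_iso_proj1:
  fixes \<phi> :: "('a::complex_hilbert_space \<Rightarrow>\<^sub>L 'a) \<Rightarrow> ('a \<Rightarrow>\<^sub>L 'a)"
  assumes iso: "mean_value_iso \<phi>" and y: "norm y = 1"
  obtains x where "norm x = 1" "\<phi> (proj1 y) = proj1 x"
proof -
  have lin: "sa_linear_bij \<phi>" using iso by (simp add: mean_value_iso_def)
  define A where "A = \<phi> (proj1 y)"
  have A: "A \<in> selfadjoint_ops" unfolding A_def by (rule lin_sa[OF lin sa_proj1])
  have "complex_of_real (qf (proj1 y) y) \<in> mean_values (proj1 y)"
    using y by (auto simp: sa_mean_values[OF sa_proj1])
  also have "\<dots> = mean_values A"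
    using iso by (simp add: mean_value_iso_def A_def sa_proj1)
  finally obtain x where x: "norm x = 1" and Ax: "qf A x = 1"
    by (auto simp: sa_mean_values[OF A] qf_proj1 cinner_self y simp del: of_real_power)
  have A_pos: "pos_op A"
    unfolding A_def by (simp add: mean_value_iso_pos[OF iso] sa_proj1 pos_proj1)
  have "\<phi> (id_blinfun - proj1 y) = id_blinfun - A"
    by (simp add: lin_diff[OF lin] sa_id sa_proj1 mean_value_iso_id[OF iso] A_def)
  then have "pos_op (id_blinfun - A)"
    using mean_value_iso_pos[OF iso sa_diff[OF sa_id sa_proj1]] pos_id_minus_proj1[OF y] by metis
  then have "blinfun_apply (id_blinfun - A) x = 0"
    by (intro pos_op_null_vector) (simp_all add: sa_diff sa_id A qf_simps x Ax)
  then have "blinfun_apply A x = x" by (simp add: blinfun.diff_left)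
  then have above: "pos_op (A - proj1 x)" by (rule proj1_below[OF A x A_pos])
  define B where "B = sa_inv \<phi> (proj1 x)"
  have B: "B \<in> selfadjoint_ops" and \<phi>B: "\<phi> B = proj1 x"
    by (simp_all add: B_def sa_inv_sa[OF lin] lin_sa_inv[OF lin] sa_proj1)
  have "B = qf B y *\<^sub>R proj1 y"
  proof (rule below_proj1[OF B y])
    show "pos_op B" using mean_value_iso_pos[OF iso B] by (simp add: \<phi>B pos_proj1)
    have "\<phi> (proj1 y - B) = A - proj1 x" by (simp add: lin_diff[OF lin] sa_proj1 B \<phi>B A_def)
    then show "pos_op (proj1 y - B)"
      using mean_value_iso_pos[OF iso sa_diff[OF sa_proj1 B, of y]] above by simp
  qed
  then have *: "proj1 x = qf B y *\<^sub>R A" by (metis \<phi>B lin_scaleR[OF lin] sa_proj1 A_def)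
  \<comment> \<open>Evaluation at x, where A has the value 1, shows that the multiple is 1.\<close>
  have "qf (proj1 x) x = 1" by (simp add: qf_proj1 cinner_self x)
  then have "qf B y = 1" using Ax by (simp add: * qf_scaleR)
  then show thesis using that[OF x] * by (simp add: A_def)
qed

text \<open>Domination involves only positivity of linear combinations of B, P and the identity, all
  of which \<phi> respects; the same b works on both sides.\<close>

lemma mean_value_iso_dominated:
  assumes iso: "mean_value_iso \<phi>" and B: "B \<in> selfadjoint_ops" and P: "P \<in> selfadjoint_ops"
  shows "dominated (\<phi> B) (\<phi> P) k \<longleftrightarrow> dominated B P k"
proof -
  have lin: "sa_linear_bij \<phi>" using iso by (simp add: mean_value_iso_def)
  define C where "C a s = a *\<^sub>R P + s *\<^sub>R (id_blinfun - P)" for a s :: real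
  have C: "C a s \<in> selfadjoint_ops" for a s
    by (simp add: C_def sa_add sa_diff sa_scaleR sa_id P)
  have \<phi>C: "a *\<^sub>R \<phi> P + s *\<^sub>R (id_blinfun - \<phi> P) = \<phi> (C a s)" for a s
    by (simp add: C_def lin_add[OF lin] lin_diff[OF lin] lin_scaleR[OF lin] sa_add sa_diff sa_scaleR
        sa_id P mean_value_iso_id[OF iso])
  have "pos_op (\<phi> (C a s) - \<phi> B) \<longleftrightarrow> pos_op (C a s - B)"
    "pos_op (\<phi> (C a s) + \<phi> B) \<longleftrightarrow> pos_op (C a s + B)" for a s
    using mean_value_iso_pos[OF iso sa_diff[OF C B]] mean_value_iso_pos[OF iso sa_add[OF C B]]
    by (simp_all add: lin_add[OF lin C B] lin_diff[OF lin C B])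
  then show ?thesis
    unfolding dominated_def \<phi>C by (simp add: C_def)
qed

text \<open>Pythagoras: \<open>B x\<close> splits into m times x and a part orthogonal to x. This
  reduces norms to the case of mean value 0, the only one that \<open>dominated\<close>
  describes.\<close>

lemma norm_apply_shift:
  assumes "norm x = 1" and "qf (B - m *\<^sub>R id_blinfun) x = 0"
  shows "(norm (blinfun_apply B x))\<^sup>2 = (norm (blinfun_apply (B - m *\<^sub>R id_blinfun) x))\<^sup>2 + m\<^sup>2"
proof -
  define w where "w = blinfun_apply (B - m *\<^sub>R id_blinfun) x"
  have "inner w x = 0" using assms(2) by (simp add: qf_def w_def)
  moreover have "blinfun_apply B x = w + m *\<^sub>R x"
    by (simp add: w_def blinfun.diff_left blinfun.scaleR_left)
  moreover have "(norm (w + m *\<^sub>R x))\<^sup>2 = (norm w)\<^sup>2 + m\<^sup>2 * (norm x)\<^sup>2 + 2 * m * inner w x"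
    unfolding power2_norm_eq_inner
    by (simp add: inner_add_left inner_add_right inner_commute power2_eq_square)
  ultimately show ?thesis
    using assms(1) by (simp add: w_def[symmetric])
qed

text \<open>The vector x spans the line whose projection \<phi> maps to \<open>proj1 y\<close>, so
  one x serves all B. Each B is shifted to mean value 0 at x, where domination recovers its norm at
  x.\<close>

lemma mean_value_iso_vector:
  fixes \<phi> :: "('a::complex_hilbert_space \<Rightarrow>\<^sub>L 'a) \<Rightarrow> ('a \<Rightarrow>\<^sub>L 'a)"
  assumes iso: "mean_value_iso \<phi>" and y: "norm y = 1"
  obtains x where "norm x = 1"
    "\<And>B. B \<in> selfadjoint_ops \<Longrightarrow> qf (\<phi> B) y = qf B x"
    "\<And>B. B \<in> selfadjoint_ops \<Longrightarrow> norm (blinfun_apply (\<phi> B) y) = norm (blinfun_apply B x)"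
proof -
  have lin: "sa_linear_bij \<phi>" using iso by (simp add: mean_value_iso_def)
  obtain x where x: "norm x = 1" and inv: "sa_inv \<phi> (proj1 y) = proj1 x"
    using mean_value_iso_proj1[OF mean_value_iso_inv[OF iso] y] .
  have \<phi>x: "\<phi> (proj1 x) = proj1 y"
    using lin_sa_inv[OF lin sa_proj1, of y] by (simp add: inv)
  have centred: "qf (\<phi> D) y = 0 \<and> norm (blinfun_apply (\<phi> D) y) \<le> k \<longleftrightarrow>
      qf D x = 0 \<and> norm (blinfun_apply D x) \<le> k" if "D \<in> selfadjoint_ops" "0 \<le> k" for D k
    using that mean_value_iso_dominated[OF iso that(1) sa_proj1, of x k]
    by (simp add: \<phi>x dominated_proj1_iff lin_sa[OF lin] x y)
  have "qf (\<phi> B) y = qf B x \<and> norm (blinfun_apply (\<phi> B) y) = norm (blinfun_apply B x)"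
    if B: "B \<in> selfadjoint_ops" for B
  proof -
    define m where "m = qf B x"
    define D where "D = B - m *\<^sub>R id_blinfun"
    have D: "D \<in> selfadjoint_ops" by (simp add: D_def sa_diff sa_scaleR B sa_id)
    have \<phi>D: "\<phi> D = \<phi> B - m *\<^sub>R id_blinfun"
      by (simp add: D_def lin_diff[OF lin] lin_scaleR[OF lin] B sa_scaleR sa_id
          mean_value_iso_id[OF iso])
    have Dx: "qf D x = 0" by (simp add: D_def qf_simps x m_def)
    \<comment> \<open>Taking for k each of the two norms in turn gives the two inequalities between
      them.\<close>
    have Dy: "qf (\<phi> D) y = 0" "norm (blinfun_apply (\<phi> D) y) \<le> norm (blinfun_apply D x)"
      using centred[OF D, of "norm (blinfun_apply D x)"] Dx by auto
    then have "norm (blinfun_apply (\<phi> D) y) = norm (blinfun_apply D x)"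
      using centred[OF D, of "norm (blinfun_apply (\<phi> D) y)"] by auto
    then have "(norm (blinfun_apply (\<phi> B) y))\<^sup>2 = (norm (blinfun_apply B x))\<^sup>2"
      using norm_apply_shift[OF x, of B m] norm_apply_shift[OF y, of "\<phi> B" m] Dx Dy(1)
      by (simp add: \<phi>D[symmetric] D_def[symmetric])
    moreover have "qf (\<phi> B) y = m" using Dy(1) by (simp add: \<phi>D qf_simps y)
    ultimately show ?thesis by (simp add: m_def)
  qed
  then show thesis using that[OF x] by blast
qed

text \<open>The same x serves B and its square: the form of the square at x is the squared norm of
  \<open>B x\<close>, which equals that of \<open>\<phi> B\<close> at y.\<close>

lemma mean_value_iso_square:
  assumes iso: "mean_value_iso \<phi>" and B: "B \<in> selfadjoint_ops"
  shows "\<phi> (B o\<^sub>L B) = \<phi> B o\<^sub>L \<phi> B"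
proof -
  have lin: "sa_linear_bij \<phi>" using iso by (simp add: mean_value_iso_def)
  note [simp] = lin_sa[OF lin] sa_square B
  show ?thesis
  proof (rule sa_eqI)
    fix y :: 'a assume "norm y = 1"
    from mean_value_iso_vector[OF iso this] obtain x where
      "\<And>B. B \<in> selfadjoint_ops \<Longrightarrow> qf (\<phi> B) y = qf B x"
      "\<And>B. B \<in> selfadjoint_ops \<Longrightarrow> norm (blinfun_apply (\<phi> B) y) = norm (blinfun_apply B x)"
      by metis
    then show "qf (\<phi> (B o\<^sub>L B)) y = qf (\<phi> B o\<^sub>L \<phi> B) y" by (simp add: qf_square)
  qed simp_all
qed

lemma square_add:
  "(A + B) o\<^sub>L (A + B) = (A o\<^sub>L A) + ((A o\<^sub>L B) + (B o\<^sub>L A)) + (B o\<^sub>L B)"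
  by (rule blinfun_eqI) (simp add: blinfun.add_left blinfun.add_right)

text \<open>Polarisation: the square law at A + B, minus those at A and B, is the Jordan
  identity.\<close>

lemma mean_value_iso_jordan:
  assumes iso: "mean_value_iso \<phi>"
  shows "jordan_automorphism \<phi>"
proof -
  have lin: "sa_linear_bij \<phi>" using iso by (simp add: mean_value_iso_def)
  have "\<phi> ((A o\<^sub>L B) + (B o\<^sub>L A)) = (\<phi> A o\<^sub>L \<phi> B) + (\<phi> B o\<^sub>L \<phi> A)"
    if A: "A \<in> selfadjoint_ops" and B: "B \<in> selfadjoint_ops" for A B
  proof -
    have "\<phi> ((A + B) o\<^sub>L (A + B)) = (\<phi> A + \<phi> B) o\<^sub>L (\<phi> A + \<phi> B)"
      by (simp add: mean_value_iso_square[OF iso] sa_add A B lin_add[OF lin])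
    then show ?thesis
      by (simp add: square_add lin_add[OF lin] sa_add sa_square sa_jordan A B
          mean_value_iso_square[OF iso])
  qed
  then show ?thesis using lin by (simp add: jordan_automorphism_def sa_linear_bij_def)
qed

section \<open>Square roots of coercive operators\<close>

text \<open>Needed for completeness of the set on which Banach's fixed point theorem is applied.
  Writing the imaginary part of \<open>cinner\<close> as a real inner product reduces the claim to
  continuity of \<open>inner\<close>.\<close>

lemma closed_selfadjoint_ops: "closed (selfadjoint_ops :: ('a::complex_hilbert_space \<Rightarrow>\<^sub>L 'a) set)"
proof -
  have cinner_eq: "cinner x y = Complex (inner x y) (inner x (\<i> *\<^sub>C y))" for x y :: 'a
    by (simp add: complex_eq_iff re_cinner cinner_scaleC_right)
  have "bounded_linear (\<lambda>x::'a. c *\<^sub>C x)" for c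
    by (rule bounded_linear_intro[where K = "cmod c"])
      (simp_all add: scaleC_add_right scaleC_scaleR_commute norm_scaleC)
  then have scaleC: "continuous_on UNIV (\<lambda>A :: 'a \<Rightarrow>\<^sub>L 'a. c *\<^sub>C blinfun_apply A x)" for c x
    by (rule bounded_linear.continuous_on) (intro continuous_intros)
  have "(selfadjoint_ops :: ('a \<Rightarrow>\<^sub>L 'a) set) =
    {A. (\<forall>c x. blinfun_apply A (c *\<^sub>C x) = c *\<^sub>C blinfun_apply A x) \<and>
      (\<forall>x y. inner (blinfun_apply A x) y = inner x (blinfun_apply A y) \<and>
        inner (blinfun_apply A x) (\<i> *\<^sub>C y) = inner x (\<i> *\<^sub>C blinfun_apply A y))}"
    by (simp only: selfadjoint_ops_def cinner_eq complex.inject)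
  also have "closed \<dots>"
    by (intro closed_Collect_conj closed_Collect_all closed_Collect_eq continuous_intros scaleC)
  finally show ?thesis .
qed

text \<open>The operator \<open>R = 1 - S\<close> satisfies \<open>R\<^sup>2 = 1 - T\<close> iff S is a fixed point of
  \<open>S \<mapsto> (T + S\<^sup>2) / 2\<close>, which is a contraction of the ball of radius \<open>\<parallel>T\<parallel> < 1\<close>.\<close>

lemma square_root_near_id:
  fixes T :: "'a::complex_hilbert_space \<Rightarrow>\<^sub>L 'a"
  assumes T: "T \<in> selfadjoint_ops" and less: "norm T < 1"
  obtains R where "R \<in> selfadjoint_ops" "R o\<^sub>L R = id_blinfun - T"
proof -
  define X where "X = selfadjoint_ops \<inter> cball (0::'a \<Rightarrow>\<^sub>L 'a) (norm T)"
  define f where "f S = (1/2) *\<^sub>R (T + (S o\<^sub>L S))" for S :: "'a \<Rightarrow>\<^sub>L 'a"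
  have "\<exists>!S\<in>X. f S = S"
  proof (rule Banach_fix)
    show "complete X"
      unfolding X_def complete_eq_closed by (intro closed_Int closed_selfadjoint_ops closed_cball)
    show "X \<noteq> {}" using sa_zero by (force simp: X_def)
    show "0 \<le> norm T" "norm T < 1" using less by auto
    show "f ` X \<subseteq> X"
    proof
      fix F assume "F \<in> f ` X"
      then obtain S where S: "S \<in> selfadjoint_ops" "norm S \<le> norm T" and F: "F = f S"
        by (auto simp: X_def)
      have "norm (S o\<^sub>L S) \<le> norm S * norm S" by (rule norm_blinfun_compose)
      also have "\<dots> \<le> norm T * 1" using S less by (intro mult_mono) auto
      finally have "norm F \<le> norm T"
        using norm_triangle_ineq[of T "S o\<^sub>L S"] by (simp add: F f_def)
      then show "F \<in> X" using S T by (simp add: X_def F f_def sa_scaleR sa_add sa_square)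
    qed
    fix S S' assume "S \<in> X" "S' \<in> X"
    then have le: "norm S \<le> norm T" "norm S' \<le> norm T" by (auto simp: X_def)
    \<comment> \<open>This splitting of the difference of squares does not assume that S and S'
      commute.\<close>
    have "f S - f S' = (1/2) *\<^sub>R ((S o\<^sub>L (S - S')) + ((S - S') o\<^sub>L S'))"
      by (rule blinfun_eqI)
        (simp add: f_def blinfun.add_left blinfun.diff_left blinfun.scaleR_left blinfun.diff_right
          scaleR_right_diff_distrib[symmetric])
    then have "norm (f S - f S') = norm ((S o\<^sub>L (S - S')) + ((S - S') o\<^sub>L S')) / 2" by simp
    also have "\<dots> \<le> (norm S * norm (S - S') + norm (S - S') * norm S') / 2"
      by (intro divide_right_mono norm_triangle_le add_mono norm_blinfun_compose) auto
    also have "\<dots> \<le> (norm T * norm (S - S') + norm (S - S') * norm T) / 2"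
      using le by (intro divide_right_mono add_mono mult_right_mono mult_left_mono) auto
    finally show "dist (f S) (f S') \<le> norm T * dist S S'" by (simp add: dist_norm mult.commute)
  qed
  then obtain S where "S \<in> X" and fixed: "f S = S" by blast
  then have S: "S \<in> selfadjoint_ops" by (simp add: X_def)
  have "T + (S o\<^sub>L S) = S + S"
  proof -
    have "2 *\<^sub>R f S = S + S" by (simp add: fixed scaleR_2)
    then show ?thesis by (simp add: f_def)
  qed
  then have "blinfun_apply T x + blinfun_apply S (blinfun_apply S x) = blinfun_apply S x + blinfun_apply S x"
    for x by (metis blinfun.add_left blinfun_apply_blinfun_compose)
  then have "(id_blinfun - S) o\<^sub>L (id_blinfun - S) = id_blinfun - T"
    by (intro blinfun_eqI) (simp add: blinfun.diff_left blinfun.diff_right algebra_simps)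
  then show thesis using that sa_diff[OF sa_id S] by blast
qed

text \<open>Polarisation bounds \<open>inner (A x) y\<close> by the forms at x + y and x - y, and
  the parallelogram law adds up the bounds.\<close>

lemma sa_norm_le:
  assumes A: "A \<in> selfadjoint_ops" and m: "0 \<le> m" and bound: "\<And>x. \<bar>qf A x\<bar> \<le> m * (norm x)\<^sup>2"
  shows "norm A \<le> m"
proof (rule norm_blinfun_bound[OF m])
  fix x :: 'a
  define n where "n = norm (blinfun_apply A x)"
  show "norm (blinfun_apply A x) \<le> m * norm x"
  proof (cases "n = 0 \<or> x = 0")
    case False
    then have n: "n > 0" and x: "norm x > 0" by (auto simp: n_def)
    \<comment> \<open>The direction of \<open>A x\<close> makes the inner product equal to
      \<open>norm x * n\<close>; the length of x balances the parallelogram law.\<close>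
    define y where "y = (norm x / n) *\<^sub>R blinfun_apply A x"
    have y: "norm y = norm x" using n by (simp add: y_def n_def[symmetric])
    have "4 * inner (blinfun_apply A x) y = qf A (x + y) - qf A (x + (-1) *\<^sub>R y)"
      unfolding qf_plus[OF A] qf_scale by simp
    also have "\<dots> \<le> m * (norm (x + y))\<^sup>2 + m * (norm (x + (-1) *\<^sub>R y))\<^sup>2"
      using bound[of "x + y"] bound[of "x + (-1) *\<^sub>R y"] by linarith
    also have "\<dots> = 2 * m * ((norm x)\<^sup>2 + (norm y)\<^sup>2)"
      by (simp add: power2_norm_eq_inner inner_add_left inner_add_right inner_diff_left
          inner_diff_right algebra_simps inner_commute)
    also have "\<dots> = 4 * m * (norm x)\<^sup>2" by (simp add: y)
    finally have "inner (blinfun_apply A x) y \<le> m * (norm x)\<^sup>2" by simp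
    moreover have "inner (blinfun_apply A x) y = norm x * n"
      using n by (simp add: y_def power2_norm_eq_inner[symmetric] n_def[symmetric] power2_eq_square)
    ultimately show ?thesis using x by (simp add: n_def power2_eq_square mult.commute)
  qed (use m in \<open>auto simp: n_def\<close>)
qed

text \<open>Division by c brings A within distance less than 1 of the identity. Coercivity is what
  keeps the distance strictly below 1.\<close>

lemma square_root_coercive:
  fixes A :: "'a::complex_hilbert_space \<Rightarrow>\<^sub>L 'a"
  assumes A: "A \<in> selfadjoint_ops" and e: "e > 0" and pos: "pos_op (A - e *\<^sub>R id_blinfun)"
  obtains R where "R \<in> selfadjoint_ops" "R o\<^sub>L R = A"
proof -
  \<comment> \<open>The norm of A makes the form of T nonnegative; the summand e gives c > 0 and e /
    c \<le> 1.\<close>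
  define c where "c = norm A + e"
  have c: "c > 0" "e / c \<le> 1" using e by (auto simp: c_def add_nonneg_pos)
  define T where "T = id_blinfun - (1 / c) *\<^sub>R A"
  have T: "T \<in> selfadjoint_ops" by (simp add: T_def sa_diff sa_id sa_scaleR A)
  have "norm T \<le> 1 - e / c"
  proof (rule sa_norm_le[OF T])
    fix x
    have "qf A x \<le> c * (norm x)\<^sup>2"
      using qf_le_norm[of A x] e by (simp add: c_def distrib_right add_increasing2)
    then have "0 \<le> qf T x" using c by (simp add: T_def qf_simps field_simps)
    moreover have "e * (norm x)\<^sup>2 \<le> qf A x"
      using pos by (simp add: pos_op_def qf_simps)
    then have "qf T x \<le> (1 - e / c) * (norm x)\<^sup>2"
      using c by (simp add: T_def qf_simps field_simps)
    ultimately show "\<bar>qf T x\<bar> \<le> (1 - e / c) * (norm x)\<^sup>2" by simp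
  qed (use c in simp)
  also have "\<dots> < 1" using c e by simp
  finally obtain R where R: "R \<in> selfadjoint_ops" "R o\<^sub>L R = id_blinfun - T"
    using square_root_near_id[OF T] by blast
  have "(sqrt c *\<^sub>R R) o\<^sub>L (sqrt c *\<^sub>R R) = c *\<^sub>R (R o\<^sub>L R)"
    using c by (intro blinfun_eqI) (simp add: blinfun.scaleR_left blinfun.scaleR_right)
  also have "\<dots> = A" using c by (simp add: R(2) T_def)
  finally show thesis using that sa_scaleR[OF R(1)] by blast
qed

section \<open>Jordan automorphisms\<close>

lemma jordan_lin: "jordan_automorphism \<phi> \<Longrightarrow> sa_linear_bij \<phi>"
  by (simp add: jordan_automorphism_def sa_linear_bij_def)

lemma jordan_product:
  "\<lbrakk>jordan_automorphism \<phi>; A \<in> selfadjoint_ops; B \<in> selfadjoint_ops\<rbrakk> \<Longrightarrow>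
    \<phi> ((A o\<^sub>L B) + (B o\<^sub>L A)) = (\<phi> A o\<^sub>L \<phi> B) + (\<phi> B o\<^sub>L \<phi> A)"
  by (simp add: jordan_automorphism_def)

lemma jordan_inv:
  assumes "jordan_automorphism \<phi>"
  shows "jordan_automorphism (sa_inv \<phi>)"
proof -
  note lin = jordan_lin[OF assms]
  have "sa_inv \<phi> ((A o\<^sub>L B) + (B o\<^sub>L A)) =
      (sa_inv \<phi> A o\<^sub>L sa_inv \<phi> B) + (sa_inv \<phi> B o\<^sub>L sa_inv \<phi> A)"
    if "A \<in> selfadjoint_ops" "B \<in> selfadjoint_ops" for A B
    using that by (intro sa_inv_eqI[OF lin])
      (simp_all add: sa_jordan sa_inv_sa[OF lin] jordan_product[OF assms] lin_sa_inv[OF lin])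
  then show ?thesis
    using sa_linear_bij_inv[OF lin] by (simp add: jordan_automorphism_def sa_linear_bij_def)
qed

lemma jordan_square:
  assumes "jordan_automorphism \<phi>" and A: "A \<in> selfadjoint_ops"
  shows "\<phi> (A o\<^sub>L A) = \<phi> A o\<^sub>L \<phi> A"
proof -
  have "2 *\<^sub>R \<phi> (A o\<^sub>L A) = 2 *\<^sub>R (\<phi> A o\<^sub>L \<phi> A)"
    using jordan_product[OF assms(1) A A] lin_add[OF jordan_lin[OF assms(1)] sa_square[OF A] sa_square[OF A]]
    by (simp add: scaleR_2)
  then show ?thesis by simp
qed

text \<open>The triple product is expressed by Jordan products alone, so Jordan automorphisms must
  preserve it.\<close>

lemma sandwich_eq:
  "2 *\<^sub>R (A o\<^sub>L B o\<^sub>L A) =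
    ((A o\<^sub>L ((A o\<^sub>L B) + (B o\<^sub>L A))) + (((A o\<^sub>L B) + (B o\<^sub>L A)) o\<^sub>L A)) -
    (((A o\<^sub>L A) o\<^sub>L B) + (B o\<^sub>L (A o\<^sub>L A)))"
  by (rule blinfun_eqI)
    (simp add: blinfun.add_left blinfun.add_right blinfun.diff_left blinfun.scaleR_left scaleR_2)

lemma jordan_sandwich:
  assumes jordan: "jordan_automorphism \<phi>"
    and A: "A \<in> selfadjoint_ops" and B: "B \<in> selfadjoint_ops"
  shows "\<phi> (A o\<^sub>L B o\<^sub>L A) = \<phi> A o\<^sub>L \<phi> B o\<^sub>L \<phi> A"
proof -
  note lin = jordan_lin[OF jordan]
  have "2 *\<^sub>R \<phi> (A o\<^sub>L B o\<^sub>L A) = \<phi> (2 *\<^sub>R (A o\<^sub>L B o\<^sub>L A))"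
    by (simp add: lin_scaleR[OF lin] sa_sandwich A B)
  also have "\<dots> = 2 *\<^sub>R (\<phi> A o\<^sub>L \<phi> B o\<^sub>L \<phi> A)"
    unfolding sandwich_eq
    by (simp only: lin_diff[OF lin] jordan_product[OF jordan] jordan_square[OF jordan]
        sa_jordan sa_square A B)
  finally show ?thesis by simp
qed

text \<open>Let E be the preimage of the identity. Mapping the Jordan product of the identity and E
  gives twice the identity when computed first, and twice the image of the identity when computed
  after \<phi>.\<close>

lemma jordan_id:
  fixes \<phi> :: "('a::complex_hilbert_space \<Rightarrow>\<^sub>L 'a) \<Rightarrow> ('a \<Rightarrow>\<^sub>L 'a)"
  assumes "jordan_automorphism \<phi>"
  shows "\<phi> id_blinfun = id_blinfun"
proof -
  note lin = jordan_lin[OF assms]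
  define E where "E = sa_inv \<phi> id_blinfun"
  have E: "E \<in> selfadjoint_ops" "\<phi> E = id_blinfun"
    by (simp_all add: E_def sa_inv_sa[OF lin] lin_sa_inv[OF lin] sa_id)
  have comp: "X o\<^sub>L id_blinfun = X" "id_blinfun o\<^sub>L X = X" for X :: "'a \<Rightarrow>\<^sub>L 'a"
    by (simp_all add: blinfun_eqI)
  have "2 *\<^sub>R id_blinfun = 2 *\<^sub>R \<phi> id_blinfun"
    using jordan_product[OF assms sa_id E(1)]
    by (simp only: comp lin_add[OF lin E(1) E(1)] E(2) scaleR_2)
  then show ?thesis by simp
qed

text \<open>Adding e times the identity makes A coercive, hence a square, and \<phi> maps squares to
  squares. Then e tends to 0.\<close>

lemma jordan_pos:
  assumes jordan: "jordan_automorphism \<phi>" and A: "A \<in> selfadjoint_ops" and pos: "pos_op A"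
  shows "pos_op (\<phi> A)"
  unfolding pos_op_def
proof
  fix x
  note lin = jordan_lin[OF jordan]
  have "- qf (\<phi> A) x \<le> e * (norm x)\<^sup>2" if e: "e > 0" for e
  proof -
    have "A + e *\<^sub>R id_blinfun \<in> selfadjoint_ops" by (simp add: sa_add A sa_scaleR sa_id)
    then obtain R where R: "R \<in> selfadjoint_ops" "R o\<^sub>L R = A + e *\<^sub>R id_blinfun"
      by (rule square_root_coercive[OF _ e]) (simp_all add: pos)
    have "\<phi> A + e *\<^sub>R id_blinfun = \<phi> (R o\<^sub>L R)"
      by (simp add: R(2) lin_add[OF lin] lin_scaleR[OF lin] A sa_scaleR sa_id jordan_id[OF jordan])
    also have "\<dots> = \<phi> R o\<^sub>L \<phi> R" by (rule jordan_square[OF jordan R(1)])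
    finally have "qf (\<phi> A + e *\<^sub>R id_blinfun) x = (norm (blinfun_apply (\<phi> R) x))\<^sup>2"
      by (simp add: qf_square lin_sa[OF lin R(1)])
    then have "qf (\<phi> A) x + e * (norm x)\<^sup>2 = (norm (blinfun_apply (\<phi> R) x))\<^sup>2"
      by (simp add: qf_simps)
    then show ?thesis using zero_le_power2[of "norm (blinfun_apply (\<phi> R) x)"] by linarith
  qed
  then have "- qf (\<phi> A) x \<le> 0" by (rule le_zero_of_le_small)
  then show "0 \<le> qf (\<phi> A) x" by simp
qed

text \<open>No uniform lower bound is asked. Applied to A - r with r the infimum of the mean values,
  it says that r is not attained.\<close>

definition strictly_pos_op :: "('a::complex_hilbert_space \<Rightarrow>\<^sub>L 'a) \<Rightarrow> bool" where
  "strictly_pos_op A \<longleftrightarrow> (\<forall>x. x \<noteq> 0 \<longrightarrow> 0 < qf A x)"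

text \<open>A positive operator A fails to be strictly positive iff it has a kernel, and this is visible
  in the Jordan structure: it means that \<open>A B A = 0\<close> for some \<open>B \<noteq> 0\<close>.\<close>

lemma jordan_strictly_pos:
  fixes \<phi> :: "('a::complex_hilbert_space \<Rightarrow>\<^sub>L 'a) \<Rightarrow> ('a \<Rightarrow>\<^sub>L 'a)"
  assumes jordan: "jordan_automorphism \<phi>" and A: "A \<in> selfadjoint_ops"
    and strict: "strictly_pos_op A"
  shows "strictly_pos_op (\<phi> A)"
proof (rule ccontr)
  note lin = jordan_lin[OF jordan]
  have "pos_op A"
    unfolding pos_op_def
  proof
    fix x show "0 \<le> qf A x"
      using strict by (cases "x = 0") (auto simp: strictly_pos_op_def qf_def intro: less_imp_le)
  qed
  then have pos: "pos_op (\<phi> A)" by (rule jordan_pos[OF jordan A])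
  assume "\<not> strictly_pos_op (\<phi> A)"
  then obtain x where "x \<noteq> 0" "qf (\<phi> A) x \<le> 0" by (auto simp: strictly_pos_op_def not_less)
  then have "qf (\<phi> A) x = 0" using pos by (simp add: pos_op_def antisym)
  with \<open>x \<noteq> 0\<close> obtain u where u: "norm u = 1" "qf (\<phi> A) u = 0"
    using qf_normalize[of x "\<phi> A"] by (metis mult_eq_0_iff norm_eq_zero power_eq_0_iff)
  then have Au: "blinfun_apply (\<phi> A) u = 0"
    by (intro pos_op_null_vector pos lin_sa[OF lin A]) auto
  \<comment> \<open>The projection onto a kernel vector of \<open>\<phi> A\<close> is annihilated by
    sandwiching; its preimage is the nonzero B with ABA = 0.\<close>
  define B where "B = sa_inv \<phi> (proj1 u)"
  have B: "B \<in> selfadjoint_ops" and \<phi>B: "\<phi> B = proj1 u"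
    by (simp_all add: B_def sa_inv_sa[OF lin] lin_sa_inv[OF lin] sa_proj1)
  have zero: "0 *\<^sub>C y = 0" for y :: 'a using scaleR_scaleC[of 0 y] by simp
  have cinner_zero: "cinner y 0 = 0" for y :: 'a using cinner_scaleC_right[of y 0 0] by (simp add: zero)
  have "\<phi> (A o\<^sub>L B o\<^sub>L A) = 0"
    by (intro blinfun_eqI)
      (simp add: jordan_sandwich[OF jordan A B] \<phi>B proj1_apply sa_cinner[OF lin_sa[OF lin A]] Au
        cinner_zero zero blinfun.zero_right)
  then have "A o\<^sub>L B o\<^sub>L A = 0"
    using lin_inj[OF lin _ sa_sandwich[OF A B] sa_zero] lin_zero[OF lin] by metis
  then have ABA: "blinfun_apply A (blinfun_apply B (blinfun_apply A z)) = 0" for z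
    by (metis blinfun_apply_blinfun_compose zero_blinfun.rep_eq)
  have inj: "v = 0" if "blinfun_apply A v = 0" for v
    using strict that by (auto simp: strictly_pos_op_def qf_def)
  \<comment> \<open>Injectivity of A cancels the left factor of ABA = 0. Taking adjoints in BA = 0
    gives AB = 0, and cancelling again gives B = 0.\<close>
  have BA: "blinfun_apply B (blinfun_apply A z) = 0" for z by (rule inj[OF ABA])
  have "inner (blinfun_apply A (blinfun_apply B z)) w = 0" for z w
    by (simp add: sa_symmetric[OF A] sa_symmetric[OF B] BA)
  then have "blinfun_apply A (blinfun_apply B z) = 0" for z by (metis inner_eq_zero_iff)
  then have "blinfun_apply B z = 0" for z by (rule inj)
  then have "B = 0" by (intro blinfun_eqI) simp
  then have "proj1 u = 0" using \<phi>B lin_zero[OF lin] by simp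
  then show False using proj1_self[OF u(1)] u(1) by auto
qed

text \<open>Convexity of the numerical range: the segment between vectors at which the form has opposite
  signs avoids 0.\<close>

lemma not_mean_value_iff:
  fixes A :: "'a::complex_hilbert_space \<Rightarrow>\<^sub>L 'a"
  assumes A: "A \<in> selfadjoint_ops"
  shows "complex_of_real r \<notin> mean_values A \<longleftrightarrow>
    strictly_pos_op (A - r *\<^sub>R id_blinfun) \<or> strictly_pos_op (r *\<^sub>R id_blinfun - A)"
proof
  assume strict: "strictly_pos_op (A - r *\<^sub>R id_blinfun) \<or> strictly_pos_op (r *\<^sub>R id_blinfun - A)"
  have "qf A x \<noteq> r" if x: "norm x = 1" for x
  proof -
    have "x \<noteq> 0" using x by auto
    then have "0 < qf (A - r *\<^sub>R id_blinfun) x \<or> 0 < qf (r *\<^sub>R id_blinfun - A) x"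
      using strict by (auto simp: strictly_pos_op_def)
    then show ?thesis by (auto simp: qf_simps x)
  qed
  then show "complex_of_real r \<notin> mean_values A"
    by (auto simp: sa_mean_values[OF A])
next
  assume r: "complex_of_real r \<notin> mean_values A"
  define D where "D = A - r *\<^sub>R id_blinfun"
  have ne: "qf D z \<noteq> 0" if z: "z \<noteq> 0" for z
  proof
    assume "qf D z = 0"
    then obtain u where u: "norm u = 1" "qf D u = 0"
      using qf_normalize[OF z, of D] z by (metis mult_eq_0_iff norm_eq_zero power_eq_0_iff)
    then have "qf A u = r" by (simp add: D_def qf_simps)
    then show False using r u by (auto simp: sa_mean_values[OF A])
  qed
  show "strictly_pos_op (A - r *\<^sub>R id_blinfun) \<or> strictly_pos_op (r *\<^sub>R id_blinfun - A)"
  proof (rule ccontr)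
    assume "\<not> ?thesis"
    then obtain x y where x: "x \<noteq> 0" "qf D x \<le> 0" and y: "y \<noteq> 0" "0 \<le> qf D y"
      by (auto simp: strictly_pos_op_def D_def qf_diff not_less)
    then have x': "qf D x < 0" and y': "0 < qf D y" using ne by (simp_all add: order_less_le)
    define g where "g t = (1 - t) *\<^sub>R x + t *\<^sub>R y" for t :: real
    have "continuous_on {0..1} (\<lambda>t. qf D (g t))"
      unfolding qf_def g_def by (intro continuous_intros)
    then obtain t where "0 \<le> t" "t \<le> 1" "qf D (g t) = 0"
      using IVT'[of "\<lambda>t. qf D (g t)" 0 0 1] x y by (auto simp: g_def)
    \<comment> \<open>A zero of the form on the segment forces the segment through the origin. Then
      t y and (t - 1) x coincide, although the form has opposite signs at x and y.\<close>
    then have "g t = 0" using ne by blast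
    moreover have "t *\<^sub>R y = g t + (- (1 - t)) *\<^sub>R x" by (simp add: g_def algebra_simps)
    ultimately have "qf D (t *\<^sub>R y) = qf D ((- (1 - t)) *\<^sub>R x)" by simp
    then have eq: "t\<^sup>2 * qf D y = (1 - t)\<^sup>2 * qf D x" by (simp only: qf_scale power2_minus)
    have "0 \<le> t\<^sup>2 * qf D y" "(1 - t)\<^sup>2 * qf D x \<le> 0"
      using x y by (simp_all add: mult_nonneg_nonpos)
    then have "t\<^sup>2 * qf D y = 0" "(1 - t)\<^sup>2 * qf D x = 0" using eq by linarith+
    then show False using x' y' by simp
  qed
qed

text \<open>By contraposition: a real r missed by A gives a strictly positive A - r or r - A, and
  \<phi> carries this over to \<open>\<phi> A\<close>.\<close>

lemma jordan_mean_values_subset: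
  assumes jordan: "jordan_automorphism \<phi>" and A: "A \<in> selfadjoint_ops"
  shows "mean_values (\<phi> A) \<subseteq> mean_values A"
proof
  note lin = jordan_lin[OF jordan]
  note [simp] = sa_diff sa_scaleR sa_id A
  fix w assume w: "w \<in> mean_values (\<phi> A)"
  then obtain r where r: "w = complex_of_real r"
    by (auto simp: sa_mean_values[OF lin_sa[OF lin A]])
  have "\<phi> (A - r *\<^sub>R id_blinfun) = \<phi> A - r *\<^sub>R id_blinfun"
    "\<phi> (r *\<^sub>R id_blinfun - A) = r *\<^sub>R id_blinfun - \<phi> A"
    by (simp_all add: lin_diff[OF lin] lin_scaleR[OF lin] jordan_id[OF jordan])
  then have "strictly_pos_op (A - r *\<^sub>R id_blinfun) \<Longrightarrow> strictly_pos_op (\<phi> A - r *\<^sub>R id_blinfun)"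
    "strictly_pos_op (r *\<^sub>R id_blinfun - A) \<Longrightarrow> strictly_pos_op (r *\<^sub>R id_blinfun - \<phi> A)"
    using jordan_strictly_pos[OF jordan, of "A - r *\<^sub>R id_blinfun"]
      jordan_strictly_pos[OF jordan, of "r *\<^sub>R id_blinfun - A"] by simp_all
  then show "w \<in> mean_values A"
    using w not_mean_value_iff[OF A, of r] not_mean_value_iff[OF lin_sa[OF lin A], of r]
    unfolding r by blast
qed

lemma jordan_mean_values:
  assumes jordan: "jordan_automorphism \<phi>" and A: "A \<in> selfadjoint_ops"
  shows "mean_values (\<phi> A) = mean_values A"
proof
  note lin = jordan_lin[OF jordan]
  show "mean_values A \<subseteq> mean_values (\<phi> A)"
    \<comment> \<open>The inclusion just proved is applied to the inverse automorphism at
      \<open>\<phi> A\<close>.\<close>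
    using jordan_mean_values_subset[OF jordan_inv[OF jordan] lin_sa[OF lin A]]
    by (simp add: sa_inv_eqI[OF lin A refl])
qed (rule jordan_mean_values_subset[OF assms])

theorem mainTheorem4:
  fixes \<phi> :: "('a::complex_hilbert_space \<Rightarrow>\<^sub>L 'a) \<Rightarrow> ('a \<Rightarrow>\<^sub>L 'a)"
  assumes "bij_betw \<phi> selfadjoint_ops selfadjoint_ops"
    and "real_linear_on selfadjoint_ops \<phi>"
  shows "(\<forall>A\<in>selfadjoint_ops. mean_values (\<phi> A) = mean_values A) \<longleftrightarrow> jordan_automorphism \<phi>"
proof
  assume "\<forall>A\<in>selfadjoint_ops. mean_values (\<phi> A) = mean_values A"
  then show "jordan_automorphism \<phi>"
    using assms by (intro mean_value_iso_jordan) (simp add: mean_value_iso_def sa_linear_bij_def)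
qed (simp add: jordan_mean_values)

end
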